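(* Let $V:\mathbb Z^2\to\mathbb C$ satisfy $|V(n)|\le C\langle n\rangle^{-\kappa}$ for all $n\in\mathbb Z^2$, for some $\kappa>2$ and $C>0$. If $u\in\ell^2(\mathbb Z^2)$ satisfies $(\Delta+V)u=0$, then $u=0$. Consequently, $0$ is not an eigenvalue of $\Delta+V$ on $\ell^2(\mathbb Z^2)$.
   Context: For $n\in\mathbb Z^2$, $|n|=(n_1^2+n_2^2)^{1/2}$ and $\langle n\rangle=(1+|n|^2)^{1/2}$. $\Delta$ is the (uncentered) nearest-neighbor adjacency operator $(\Delta u)(n)=\sum_{j=1}^2\bigl(u(n+e_j)+u(n-e_j)\bigr)$, with $e_1,e_2$ the standard basis vectors, and $V$ acts by multiplication: $(Vu)(n)=V(n)u(n)$. Functions $u$ are complex-valued. *)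

theory Defs
  imports "HOL-Analysis.Analysis"
begin

definition lattice_norm :: "int \<times> int \<Rightarrow> real" where
  "lattice_norm n = sqrt ((real_of_int (fst n))\<^sup>2 + (real_of_int (snd n))\<^sup>2)"

definition japanese_bracket :: "int \<times> int \<Rightarrow> real" where
  "japanese_bracket n = sqrt (1 + (lattice_norm n)\<^sup>2)"

text \<open>Uncentered nearest-neighbor adjacency operator: there is no term in \<open>u n\<close>.\<close>

definition adjacency_op :: "(int \<times> int \<Rightarrow> complex) \<Rightarrow> int \<times> int \<Rightarrow> complex" where
  "adjacency_op u n = (\<Sum>e\<in>{(1, 0), (0, 1)}. u (n + e) + u (n - e))"

definition mult_op ::
    "(int \<times> int \<Rightarrow> complex) \<Rightarrow> (int \<times> int \<Rightarrow> complex) \<Rightarrow> int \<times> int \<Rightarrow> complex" where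
  "mult_op V u n = V n * u n"

definition schroedinger_op ::
    "(int \<times> int \<Rightarrow> complex) \<Rightarrow> (int \<times> int \<Rightarrow> complex) \<Rightarrow> int \<times> int \<Rightarrow> complex" where
  "schroedinger_op V u n = adjacency_op u n + mult_op V u n"

definition ell2 :: "(int \<times> int \<Rightarrow> complex) set" where
  "ell2 = {u. (\<lambda>n. (cmod (u n))\<^sup>2) summable_on UNIV}"

definition is_eigenvalue_on_ell2 ::
    "((int \<times> int \<Rightarrow> complex) \<Rightarrow> int \<times> int \<Rightarrow> complex) \<Rightarrow> complex \<Rightarrow> bool" where
  "is_eigenvalue_on_ell2 T z \<longleftrightarrow>
     (\<exists>u\<in>ell2. u \<noteq> (\<lambda>n. 0) \<and> T u = (\<lambda>n. z * u n))"

end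

theory Submission imports Defs begin

text \<open>In the coordinates \<open>n\<^sub>1 + n\<^sub>2\<close> and \<open>n\<^sub>1 - n\<^sub>2\<close> the adjacency operator factors as
  \<open>(A + A\<^sup>-\<^sup>1) (B + B\<^sup>-\<^sup>1)\<close> with commuting shifts, and the gauge \<open>w n = (-1)^n\<^sub>1 * u n\<close> turns
  \<open>(\<Delta> + V) u = 0\<close> into the discrete wave equation \<open>(A - A\<^sup>-\<^sup>1) (B - B\<^sup>-\<^sup>1) w = V w\<close>.
  Since \<open>w\<close> vanishes at infinity, telescoping represents \<open>w p\<close> as a sum of \<open>V w\<close> over a quadrant
  contained in the half-plane \<open>n\<^sub>1 + n\<^sub>2 > p\<^sub>1 + p\<^sub>2\<close>. As \<open>V\<close> is summable, this is a contraction on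
  a far half-plane, so \<open>w\<close> vanishes there; the same representation then propagates the zeros
  across one line \<open>n\<^sub>1 + n\<^sub>2 = const\<close> after the other.\<close>

section \<open>Unconditional sums and telescoping\<close>

lemma summable_on_UNIV_tail:
  fixes f :: "'a \<Rightarrow> real"
  assumes "f summable_on UNIV" and "\<epsilon> > 0"
  obtains F where "finite F" and "\<And>H. finite H \<Longrightarrow> H \<inter> F = {} \<Longrightarrow> \<bar>sum f H\<bar> < \<epsilon>"
proof -
  from assms(1) obtain s where "(f has_sum s) UNIV"
    by (auto simp: summable_on_def)
  then obtain F where F: "finite F" "\<And>G. finite G \<Longrightarrow> F \<subseteq> G \<Longrightarrow> dist (sum f G) s < \<epsilon> / 2"
    using assms(2) tendstoD[of "sum f" s "finite_subsets_at_top UNIV" "\<epsilon> / 2"]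
    unfolding has_sum_def eventually_finite_subsets_at_top by auto
  have "\<bar>sum f H\<bar> < \<epsilon>" if "finite H" "H \<inter> F = {}" for H
  proof -
    \<comment> \<open>Cauchy argument: both \<open>F\<close> and \<open>H \<union> F\<close> contain
      \<open>F\<close>, so both sums lie within \<open>\<epsilon> / 2\<close> of the limit, and
      their difference is the sum over \<open>H\<close>.\<close>
    have "sum f (H \<union> F) = sum f H + sum f F"
      using that F(1) by (intro sum.union_disjoint) auto
    moreover have "\<bar>sum f F - s\<bar> < \<epsilon> / 2" "\<bar>sum f (H \<union> F) - s\<bar> < \<epsilon> / 2"
      using F(2)[of F] F(2)[of "H \<union> F"] F(1) that(1) by (simp_all add: dist_real_def)
    ultimately show ?thesis by linarith
  qed
  with F(1) show ?thesis by (rule that)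
qed

text \<open>The summand is a mixed second difference: it telescopes in \<open>k\<close>, then in
  \<open>j\<close>, and only the four corners of the rectangle survive.\<close>

lemma sum_mixed_difference_telescope:
  fixes G :: "nat \<Rightarrow> nat \<Rightarrow> 'a::ab_group_add"
  shows "(\<Sum>j<J. \<Sum>k<K. G j k - G (Suc j) k - G j (Suc k) + G (Suc j) (Suc k))
    = G 0 0 - G J 0 - G 0 K + G J K"
proof -
  have "(\<Sum>k<K. G j k - G (Suc j) k - G j (Suc k) + G (Suc j) (Suc k))
      = (G j 0 - G j K) - (G (Suc j) 0 - G (Suc j) K)" for j
    by (induction K) (auto simp: algebra_simps)
  then have "(\<Sum>j<J. \<Sum>k<K. G j k - G (Suc j) k - G j (Suc k) + G (Suc j) (Suc k))
      = (\<Sum>j<J. (G j 0 - G j K) - (G (Suc j) 0 - G (Suc j) K))"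
    by simp
  also have "\<dots> = (G 0 0 - G 0 K) - (G J 0 - G J K)"
    by (rule sum_lessThan_telescope')
  finally show ?thesis by (simp add: algebra_simps)
qed

section \<open>Summability of the decay weight\<close>

lemma summable_on_int_powr:
  fixes s :: real
  assumes "s > 1"
  shows "(\<lambda>k::int. (1 + (real_of_int k)\<^sup>2) powr (- s / 2)) summable_on UNIV"
proof -
  let ?f = "\<lambda>k::int. (1 + (real_of_int k)\<^sup>2) powr (- s / 2)"
  have bound: "(1 + (real n)\<^sup>2) powr (- s / 2) \<le> real n powr (- s)" if "n \<ge> 1" for n
  proof -
    have "(1 + (real n)\<^sup>2) powr (- s / 2) \<le> ((real n)\<^sup>2) powr (- s / 2)"
      using assms that by (intro powr_mono2') auto
    also have "\<dots> = (real n powr 2) powr (- s / 2)"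
      using that by simp
    also have "\<dots> = real n powr (- s)"
      unfolding powr_powr by simp
    finally show ?thesis .
  qed
  have nat: "summable (\<lambda>n. (1 + (real n)\<^sup>2) powr (- s / 2))"
  proof (rule summable_comparison_test)
    show "\<exists>N. \<forall>n\<ge>N. norm ((1 + (real n)\<^sup>2) powr (- s / 2)) \<le> real n powr (- s)"
      using bound by (intro exI[of _ 1]) auto
    show "summable (\<lambda>n. real n powr (- s))"
      using assms by (simp add: summable_real_powr_iff)
  qed
  have "?f summable_on range int"
    using nat by (subst summable_on_reindex) (auto simp: o_def summable_on_UNIV_nonneg_real_iff)
  \<comment> \<open>\<open>Suc n\<close> keeps 0 out of the negative half, so the two ranges are
    disjoint.\<close>
  moreover have "?f summable_on range (\<lambda>n. - int (Suc n))"
  proof (subst summable_on_reindex)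
    have "(\<lambda>n. (1 + (real (Suc n))\<^sup>2) powr (- s / 2)) summable_on UNIV"
      using nat by (subst summable_on_UNIV_nonneg_real_iff, simp, subst summable_Suc_iff)
    moreover have "?f (- int (Suc n)) = (1 + (real (Suc n))\<^sup>2) powr (- s / 2)" for n
      unfolding of_int_minus of_int_of_nat_eq power2_minus ..
    ultimately show "(?f \<circ> (\<lambda>n. - int (Suc n))) summable_on UNIV"
      by (simp add: o_def)
  qed (auto simp: inj_on_def)
  ultimately have "?f summable_on (range int \<union> range (\<lambda>n. - int (Suc n)))"
    by (rule summable_on_Un_disjoint) auto
  also have "range int \<union> range (\<lambda>n. - int (Suc n)) = UNIV"
  proof (intro UNIV_eq_I[symmetric])
    show "k \<in> range int \<union> range (\<lambda>n. - int (Suc n))" for k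
      by (cases k rule: int_cases) auto
  qed
  finally show ?thesis .
qed

text \<open>The weight is dominated by a product of two one-variable weights with exponent
  \<open>\<kappa> / 2\<close> each; these are summable because
  \<open>\<kappa> / 2 > 1\<close>.\<close>

lemma summable_on_japanese_bracket:
  assumes "\<kappa> > 2"
  shows "(\<lambda>n. japanese_bracket n powr (- \<kappa>)) summable_on UNIV"
proof -
  let ?f = "\<lambda>k::int. (1 + (real_of_int k)\<^sup>2) powr (- (\<kappa> / 2) / 2)"
  have f: "?f summable_on UNIV"
    using assms by (intro summable_on_int_powr) auto
  have "(\<lambda>n. ?f (fst n) * ?f (snd n)) summable_on (UNIV \<times> UNIV)"
  proof (rule summable_on_SigmaI)
    show "((\<lambda>y. ?f (fst (x, y)) * ?f (snd (x, y))) has_sum ?f x * infsum ?f UNIV) UNIV" for x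
      using has_sum_cmult_right[OF has_sum_infsum[OF f], of "?f x"] by simp
    show "(\<lambda>x. ?f x * infsum ?f UNIV) summable_on UNIV"
      using f by (rule summable_on_cmult_left)
  qed auto
  then have "(\<lambda>n. ?f (fst n) * ?f (snd n)) summable_on UNIV"
    by simp
  then show ?thesis
  proof (rule summable_on_comparison_test)
    fix n :: "int \<times> int"
    define x y where "x = (real_of_int (fst n))\<^sup>2" and "y = (real_of_int (snd n))\<^sup>2"
    have xy: "x \<ge> 0" "y \<ge> 0" by (auto simp: x_def y_def)
    have "japanese_bracket n = (1 + x + y) powr (1 / 2)"
      using xy by (simp add: japanese_bracket_def lattice_norm_def x_def y_def powr_half_sqrt
          add.assoc)
    then have "japanese_bracket n powr (- \<kappa>) = ((1 + x + y) powr 2) powr (- \<kappa> / 4)"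
      by (simp add: powr_powr)
    also have "\<dots> = ((1 + x + y)\<^sup>2) powr (- \<kappa> / 4)"
      using xy by simp
    \<comment> \<open>Squaring the bracket makes room for the cross term \<open>x * y\<close> of the
      product; the inequality reverses because the exponent is negative.\<close>
    also have "\<dots> \<le> ((1 + x) * (1 + y)) powr (- \<kappa> / 4)"
    proof (rule powr_mono2')
      show "(1 + x) * (1 + y) \<le> (1 + x + y)\<^sup>2"
        using xy mult_nonneg_nonneg[OF xy] by (simp add: power2_eq_square algebra_simps)
    qed (use xy assms in auto)
    also have "\<dots> = ?f (fst n) * ?f (snd n)"
      using xy by (simp add: powr_mult x_def y_def)
    finally show "japanese_bracket n powr (- \<kappa>) \<le> ?f (fst n) * ?f (snd n)" .
  qed auto
qed

section \<open>Decay at infinity\<close>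

lemma ell2_tendsto_zero:
  assumes "u \<in> ell2"
  shows "(u \<longlongrightarrow> 0) cofinite"
proof (rule tendstoI)
  fix \<epsilon> :: real assume "\<epsilon> > 0"
  have "(\<lambda>n. (cmod (u n))\<^sup>2) summable_on UNIV"
    using assms by (simp add: ell2_def)
  then obtain F where F: "finite F"
    "\<And>H. finite H \<Longrightarrow> H \<inter> F = {} \<Longrightarrow> \<bar>\<Sum>n\<in>H. (cmod (u n))\<^sup>2\<bar> < \<epsilon>\<^sup>2"
    using \<open>\<epsilon> > 0\<close> by (elim summable_on_UNIV_tail[of _ "\<epsilon>\<^sup>2"]) auto
  have "cmod (u n) < \<epsilon>" if "n \<notin> F" for n
    using F(2)[of "{n}"] that \<open>\<epsilon> > 0\<close> by (auto intro: power2_less_imp_less)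
  then have "{n. \<not> dist (u n) 0 < \<epsilon>} \<subseteq> F" by auto
  with F(1) show "\<forall>\<^sub>F n in cofinite. dist (u n) 0 < \<epsilon>"
    unfolding eventually_cofinite by (rule rev_finite_subset)
qed

text \<open>An injective sequence leaves every finite set, so it runs to infinity in the cofinite
  sense.\<close>

lemma tendsto_compose_inj_cofinite:
  assumes "(f \<longlongrightarrow> l) cofinite" and "inj g"
  shows "(\<lambda>n::nat. f (g n)) \<longlonglongrightarrow> l"
proof -
  have "filterlim g cofinite cofinite"
    unfolding filterlim_iff eventually_cofinite
    using finite_vimageI[OF _ assms(2), of "{x. \<not> P x}" for P] by (simp add: vimage_def)
  then show ?thesis
    using filterlim_compose[OF assms(1)] by (simp add: cofinite_eq_sequentially)
qed

section \<open>The discrete wave equation\<close>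

context
  fixes w V :: "int \<times> int \<Rightarrow> complex"
  assumes wave: "\<And>p. w p - w (p + (1, 1)) - w (p + (1, -1)) + w (p + (2, 0))
      = V (p + (1, 0)) * w (p + (1, 0))"
    and lim: "(w \<longlongrightarrow> 0) cofinite"
begin

text \<open>The lattice of corners \<open>p + j (1, 1) + k (1, -1)\<close> cuts the quadrant at
  \<open>p\<close> into unit diamonds. This is the centre of the diamond with left corner
  \<open>(j, k)\<close>, hence the offset 1: \<open>wave\<close> relates its four corners to the
  source at its centre. The coordinate sum grows by \<open>1 + 2 * j\<close>.\<close>

definition quadrant_point :: "int \<times> int \<Rightarrow> nat \<times> nat \<Rightarrow> int \<times> int" where
  "quadrant_point p = (\<lambda>(j, k). p + (1 + int j + int k, int j - int k))"

lemma inj_quadrant_point: "inj (quadrant_point p)"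
  by (auto simp: inj_def quadrant_point_def)

text \<open>Summing \<open>wave\<close> over an \<open>N\<close> by \<open>N\<close> block leaves
  \<open>w\<close> at the four corners of the block. As \<open>N\<close> grows, all corners but
  \<open>p\<close> escape to infinity, so \<open>w p\<close> is the limit of the block sums.\<close>

lemma norm_le_quadrant_sum:
  assumes "\<And>N. (\<Sum>i\<in>{..<N} \<times> {..<N}. cmod (V (quadrant_point p i)) * cmod (w (quadrant_point p i))) \<le> B"
  shows "cmod (w p) \<le> B"
proof (rule tendsto_upperbound)
  let ?G = "\<lambda>j k. w (p + (int j + int k, int j - int k))"
  let ?S = "\<lambda>N. \<Sum>i\<in>{..<N} \<times> {..<N}. V (quadrant_point p i) * w (quadrant_point p i)"
  have S: "?S N = w p - ?G N 0 - ?G 0 N + ?G N N" for N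
  proof -
    have "?S N = (\<Sum>j<N. \<Sum>k<N. ?G j k - ?G (Suc j) k - ?G j (Suc k) + ?G (Suc j) (Suc k))"
      unfolding sum.cartesian_product
    proof (intro sum.cong refl, clarify)
      fix j k
      show "V (quadrant_point p (j, k)) * w (quadrant_point p (j, k))
          = ?G j k - ?G (Suc j) k - ?G j (Suc k) + ?G (Suc j) (Suc k)"
        using wave[of "p + (int j + int k, int j - int k)"]
        by (cases p) (simp add: quadrant_point_def algebra_simps)
    qed
    also have "\<dots> = w p - ?G N 0 - ?G 0 N + ?G N N"
      using sum_mixed_difference_telescope[of ?G N N] by (simp flip: zero_prod_def)
    finally show ?thesis .
  qed
  have "?S \<longlonglongrightarrow> w p - 0 - 0 + 0"
    unfolding S
    by (intro tendsto_intros tendsto_compose_inj_cofinite[OF lim]) (auto simp: inj_def)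
  then show "(\<lambda>N. cmod (?S N)) \<longlonglongrightarrow> cmod (w p)"
    using tendsto_norm by fastforce
  show "\<forall>\<^sub>F N in sequentially. cmod (?S N) \<le> B"
    using assms by (intro always_eventually allI order_trans[OF sum_norm_le[OF order_refl]])
      (simp add: norm_mult)
qed simp

lemma wave_solution_vanishes_far:
  assumes "(\<lambda>n. cmod (V n)) summable_on UNIV"
  obtains R where "\<And>n. fst n + snd n \<ge> R \<Longrightarrow> w n = 0"
proof -
  obtain F where F: "finite F"
    "\<And>H. finite H \<Longrightarrow> H \<inter> F = {} \<Longrightarrow> \<bar>\<Sum>n\<in>H. cmod (V n)\<bar> < 1 / 2"
    using summable_on_UNIV_tail[OF assms, of "1 / 2"] by auto
  from F(1) have "bdd_above ((\<lambda>n. fst n + snd n) ` F)"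
    by simp
  \<comment> \<open>\<open>R\<close> bounds the coordinate sum on \<open>F\<close>, so the points
    with sum strictly above \<open>R\<close> avoid \<open>F\<close> and carry little of the mass of
    \<open>V\<close>.\<close>
  then obtain R where R: "\<And>n. n \<in> F \<Longrightarrow> fst n + snd n \<le> R"
    by (auto simp: bdd_above_def)
  have "w p = 0" if p: "fst p + snd p \<ge> R" for p
  proof (rule ccontr)
    assume "w p \<noteq> 0"
    \<comment> \<open>Since \<open>w\<close> tends to 0, only finitely many points compete with
      \<open>p\<close>; hence the supremum of \<open>cmod (w n)\<close> over the half-plane is
      attained, at \<open>q\<close>.\<close>
    define A where "A = {n. fst n + snd n \<ge> R \<and> cmod (w n) \<ge> cmod (w p)}"
    have "finite {n. \<not> dist (w n) 0 < cmod (w p)}"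
      using tendstoD[OF lim, of "cmod (w p)"] \<open>w p \<noteq> 0\<close> by (simp add: eventually_cofinite)
    then have "finite A"
      by (rule rev_finite_subset) (auto simp: A_def)
    moreover have "p \<in> A"
      using p by (simp add: A_def)
    ultimately have "Max ((\<lambda>n. cmod (w n)) ` A) \<in> (\<lambda>n. cmod (w n)) ` A"
      by (intro Max_in) auto
    then obtain q where q: "q \<in> A" "cmod (w q) = Max ((\<lambda>n. cmod (w n)) ` A)"
      by auto
    have le: "cmod (w n) \<le> cmod (w q)" if "fst n + snd n \<ge> R" for n
    proof (cases "n \<in> A")
      case True
      then show ?thesis using \<open>finite A\<close> unfolding q(2) by (intro Max_ge) auto
    next
      case False
      then show ?thesis using q(1) that by (auto simp: A_def)
    qed
    \<comment> \<open>The quadrant at \<open>q\<close> stays in the half-plane, where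
      \<open>cmod (w q)\<close> bounds \<open>w\<close>, and avoids \<open>F\<close>, where the mass
      of \<open>V\<close> could exceed 1/2.\<close>
    have "cmod (w q) \<le> 1 / 2 * cmod (w q)"
    proof (rule norm_le_quadrant_sum)
      fix N
      let ?I = "{..<N} \<times> {..<N} :: (nat \<times> nat) set"
      have far: "fst (quadrant_point q i) + snd (quadrant_point q i) > R" for i
        using q(1) by (cases i) (auto simp: A_def quadrant_point_def)
      have "(\<Sum>i\<in>?I. cmod (V (quadrant_point q i)) * cmod (w (quadrant_point q i)))
          \<le> (\<Sum>i\<in>?I. cmod (V (quadrant_point q i)) * cmod (w q))"
        by (intro sum_mono mult_left_mono le less_imp_le[OF far]) auto
      also have "\<dots> = (\<Sum>n\<in>quadrant_point q ` ?I. cmod (V n)) * cmod (w q)"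
        using inj_on_subset[OF inj_quadrant_point] by (simp add: sum.reindex sum_distrib_right)
      also have "\<dots> \<le> 1 / 2 * cmod (w q)"
      proof (rule mult_right_mono)
        have "quadrant_point q ` ?I \<inter> F = {}"
          using R less_le_not_le far by (metis (no_types, lifting) disjoint_iff imageE)
        then show "(\<Sum>n\<in>quadrant_point q ` ?I. cmod (V n)) \<le> 1 / 2"
          using F(2)[of "quadrant_point q ` ?I"] by auto
      qed simp
      finally show "(\<Sum>i\<in>?I. cmod (V (quadrant_point q i)) * cmod (w (quadrant_point q i)))
          \<le> 1 / 2 * cmod (w q)" .
    qed
    then show False
      using q(1) \<open>w p \<noteq> 0\<close> by (auto simp: A_def)
  qed
  then show ?thesis by (rule that)
qed

lemma wave_solution_eq_0:
  assumes "(\<lambda>n. cmod (V n)) summable_on UNIV"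
  shows "w n = 0"
proof -
  obtain R where R: "\<And>n. fst n + snd n \<ge> R \<Longrightarrow> w n = 0"
    using wave_solution_vanishes_far[OF assms] by blast
  have "\<forall>n. fst n + snd n \<ge> R - int m \<longrightarrow> w n = 0" for m
  proof (induction m)
    case (Suc m)
    \<comment> \<open>Every quadrant point has coordinate sum at least one more than
      \<open>p\<close>, so the representation of \<open>w p\<close> only meets zeros already
      established.\<close>
    have "cmod (w p) \<le> 0" if "fst p + snd p \<ge> R - int (Suc m)" for p
    proof (rule norm_le_quadrant_sum)
      fix N
      have "w (quadrant_point p i) = 0" for i
      proof (cases i)
        case (Pair j k)
        have "fst (quadrant_point p i) + snd (quadrant_point p i) \<ge> R - int m"
          using that by (simp add: Pair quadrant_point_def)
        with Suc show ?thesis by blast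
      qed
      then show "(\<Sum>i\<in>{..<N} \<times> {..<N}.
          cmod (V (quadrant_point p i)) * cmod (w (quadrant_point p i))) \<le> 0"
        by simp
    qed
    then show ?case by simp
  qed (simp add: R)
  moreover have "fst n + snd n \<ge> R - int (nat (R - (fst n + snd n)))"
    by simp
  ultimately show ?thesis by blast
qed

end

section \<open>Return to the Schroedinger operator\<close>

lemma schroedinger_kernel_trivial:
  assumes V: "(\<lambda>n. cmod (V n)) summable_on UNIV"
    and u: "u \<in> ell2" and eq: "schroedinger_op V u = (\<lambda>n. 0)"
  shows "u = (\<lambda>n. 0)"
proof -
  \<comment> \<open>Horizontal neighbours get the sign opposite to the centre and vertical ones the
    same sign; this turns the sum of the four neighbours into a mixed difference along the
    diagonals.\<close>
  define w where "w n = (if even (fst n) then u n else - u n)" for n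
  have "w n = 0" for n
  proof (rule wave_solution_eq_0[OF _ _ V])
    show "w p - w (p + (1, 1)) - w (p + (1, -1)) + w (p + (2, 0))
        = V (p + (1, 0)) * w (p + (1, 0))" for p
    proof -
      obtain a b where p: "p = (a, b)" by (cases p)
      have "u (a + 2, b) + u (a, b) + (u (a + 1, b + 1) + u (a + 1, b - 1))
          + V (a + 1, b) * u (a + 1, b) = 0"
        using fun_cong[OF eq, of "(a + 1, b)"]
        by (simp add: schroedinger_op_def adjacency_op_def mult_op_def algebra_simps)
      then have "V (a + 1, b) * u (a + 1, b)
          = - (u (a + 2, b) + u (a, b) + (u (a + 1, b + 1) + u (a + 1, b - 1)))"
        by (simp only: eq_neg_iff_add_eq_0 add.commute)
      then show ?thesis
        by (simp add: p w_def)
    qed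
    have "cmod (w n) = cmod (u n)" for n
      by (simp add: w_def)
    then show "(w \<longlongrightarrow> 0) cofinite"
      using ell2_tendsto_zero[OF u] by (simp add: tendsto_iff)
  qed
  then have "u n = 0" for n
    using w_def[of n] by (simp split: if_splits)
  then show ?thesis by blast
qed

theorem theorem1:
  fixes V :: "int \<times> int \<Rightarrow> complex" and C \<kappa> :: real
  assumes "\<kappa> > 2" and "C > 0"
    and "\<And>n. cmod (V n) \<le> C * japanese_bracket n powr (- \<kappa>)"
  shows "(\<forall>u\<in>ell2. schroedinger_op V u = (\<lambda>n. 0) \<longrightarrow> u = (\<lambda>n. 0))
         \<and> \<not> is_eigenvalue_on_ell2 (schroedinger_op V) 0"
proof -
  have "(\<lambda>n. C * japanese_bracket n powr (- \<kappa>)) summable_on UNIV"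
    using summable_on_japanese_bracket[OF assms(1)] by (rule summable_on_cmult_right)
  then have "(\<lambda>n. cmod (V n)) summable_on UNIV"
    by (rule summable_on_comparison_test) (use assms(3) in auto)
  \<comment> \<open>An eigenvector for 0 is a nonzero element of the kernel in \<open>ell2\<close>,
    so both claims are the triviality of that kernel.\<close>
  then show ?thesis
    using schroedinger_kernel_trivial[of V] by (auto simp: is_eigenvalue_on_ell2_def)
qed

end
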